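(* Fix $k\ge1$ and $\rho>0$. Suppose that $\rho'\mapsto\lim_{V\to\infty}\langle N_k/V\rangle^{GC}_V(\mu_V(\rho'))$ and $\rho'\mapsto\tilde{\mathbb{K}}(\rho';[\rho,\infty))$ are continuous at $\rho'=\rho$, and that $\tilde{\mathbb{K}}(\rho;[\rho,\infty))\neq0$. Then $\lim_{V\to\infty}\langle N_k/V\rangle^{GC}_V(\mu_V(\rho))=0$ implies $\lim_{V\to\infty}\langle N_k/V\rangle^{C}_V(\rho)=0$.
   Context: Fix exponents $\alpha_1\ge\alpha_2\ge\alpha_3>0$ with $\alpha_1+\alpha_2+\alpha_3=1$, $\Lambda_V=\{x\in\mathbb{R}^3:0\le x_j\le V^{\alpha_j}\}$, one-particle Hamiltonian $-\Delta/2$ on $L^2(\Lambda_V)$ with Dirichlet boundary conditions, eigenvalues $E_1(V)<E_2(V)\le\dots$, and $N_k$ the occupation number of the $k$-th eigenstate. Perfect Bose gas at inverse temperature $\beta>0$. Canonical state at density $\rho=n/V$: $\langle\cdot\rangle^C_V(\rho)=Z_V(n)^{-1}\mathrm{Tr}(\cdot\,e^{-\beta T_V^{(n)}})$ on the symmetric $n$-particle space. Grand-canonical state at $\mu<E_1(V)$: $\langle\cdot\rangle^{GC}_V(\mu)=\Xi_V(\mu)^{-1}\mathrm{Tr}_{\text{Fock}}(\cdot\,e^{-\beta(T_V-\mu N_V)})$, $N_V=\sum_kN_k$. $\mu_V(\rho)$ is the unique $\mu<E_1(V)$ with $V^{-1}\langle N_V\rangle^{GC}_V(\mu)=\rho$.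 The Kac distribution $\tilde{\mathbb{K}}_V(\rho;dx)$ is the probability distribution of $N_V/V$ in the state $\langle\cdot\rangle^{GC}_V(\mu_V(\rho))$, so that $\langle\cdot\rangle^{GC}_V(\mu_V(\rho))=\int_{[0,\infty)}\langle\cdot\rangle^{C}_V(x)\,\tilde{\mathbb{K}}_V(\rho;dx)$; $\tilde{\mathbb{K}}(\rho;dx)=\lim_{V\to\infty}\tilde{\mathbb{K}}_V(\rho;dx)$ is its limit. Canonical limits at fixed density $\rho$ are taken with $n$ particles in volume $V=n/\rho$, $n\to\infty$. *)

theory Defs
  imports "HOL-Probability.Probability"
begin

type_synonym mode = "nat \<times> nat \<times> nat"
type_synonym occ = "mode \<Rightarrow> nat"

text \<open>Dirichlet eigenvalue of -Laplacian/2 on the box with sides V powr a1, V powr a2, V powr a3,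
  for the mode (i+1, j+1, l+1).\<close>
definition mode_energy :: "real \<Rightarrow> real \<Rightarrow> real \<Rightarrow> real \<Rightarrow> mode \<Rightarrow> real" where
  "mode_energy a1 a2 a3 V m = (case m of (i, j, l) \<Rightarrow>
     (pi^2 / 2) * ((real (Suc i) / V powr a1)^2 + (real (Suc j) / V powr a2)^2
                   + (real (Suc l) / V powr a3)^2))"

text \<open>k-th eigenvalue E_k(V) (k >= 1), counted with multiplicity.\<close>
definition eigenvalue :: "real \<Rightarrow> real \<Rightarrow> real \<Rightarrow> real \<Rightarrow> nat \<Rightarrow> real" where
  "eigenvalue a1 a2 a3 V k = Inf {E. k \<le> card {m. mode_energy a1 a2 a3 V m \<le> E}}"

definition eigenstate :: "real \<Rightarrow> real \<Rightarrow> real \<Rightarrow> real \<Rightarrow> nat \<Rightarrow> mode" where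
  "eigenstate a1 a2 a3 V k = (SOME m. mode_energy a1 a2 a3 V m = eigenvalue a1 a2 a3 V k)"

text \<open>Occupation-number basis of the bosonic Fock space.\<close>
definition supp_occ :: "occ \<Rightarrow> mode set" where
  "supp_occ c = {m. c m \<noteq> 0}"

definition fock_confs :: "occ set" where
  "fock_confs = {c. finite (supp_occ c)}"

definition total_num :: "occ \<Rightarrow> nat" where
  "total_num c = (\<Sum>m\<in>supp_occ c. c m)"

definition total_energy :: "real \<Rightarrow> real \<Rightarrow> real \<Rightarrow> real \<Rightarrow> occ \<Rightarrow> real" where
  "total_energy a1 a2 a3 V c = (\<Sum>m\<in>supp_occ c. real (c m) * mode_energy a1 a2 a3 V m)"

definition gc_weight :: "real \<Rightarrow> real \<Rightarrow> real \<Rightarrow> real \<Rightarrow> real \<Rightarrow> real \<Rightarrow> occ \<Rightarrow> real" where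
  "gc_weight a1 a2 a3 \<beta> V \<mu> c =
     exp (- \<beta> * (total_energy a1 a2 a3 V c - \<mu> * real (total_num c)))"

definition gc_state :: "real \<Rightarrow> real \<Rightarrow> real \<Rightarrow> real \<Rightarrow> real \<Rightarrow> real \<Rightarrow> (occ \<Rightarrow> real) \<Rightarrow> real" where
  "gc_state a1 a2 a3 \<beta> V \<mu> F =
     infsum (\<lambda>c. F c * gc_weight a1 a2 a3 \<beta> V \<mu> c) fock_confs
     / infsum (\<lambda>c. gc_weight a1 a2 a3 \<beta> V \<mu> c) fock_confs"

definition chem_pot :: "real \<Rightarrow> real \<Rightarrow> real \<Rightarrow> real \<Rightarrow> real \<Rightarrow> real \<Rightarrow> real" where
  "chem_pot a1 a2 a3 \<beta> V \<rho> = (THE \<mu>. \<mu> < eigenvalue a1 a2 a3 V 1 \<and>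
      gc_state a1 a2 a3 \<beta> V \<mu> (\<lambda>c. real (total_num c)) / V = \<rho>)"

definition can_state :: "real \<Rightarrow> real \<Rightarrow> real \<Rightarrow> real \<Rightarrow> real \<Rightarrow> nat \<Rightarrow> (occ \<Rightarrow> real) \<Rightarrow> real" where
  "can_state a1 a2 a3 \<beta> V n F =
     infsum (\<lambda>c. F c * exp (- \<beta> * total_energy a1 a2 a3 V c)) {c \<in> fock_confs. total_num c = n}
     / infsum (\<lambda>c. exp (- \<beta> * total_energy a1 a2 a3 V c)) {c \<in> fock_confs. total_num c = n}"

text \<open>K is the weak limit (V to infinity) of the Kac distributions, i.e. of the laws of N_V/V
  in the grand-canonical state at mu_V(rho).\<close>
definition kac_weak_limit :: "real \<Rightarrow> real \<Rightarrow> real \<Rightarrow> real \<Rightarrow> real \<Rightarrow> real measure \<Rightarrow> bool" where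
  "kac_weak_limit a1 a2 a3 \<beta> \<rho> K \<longleftrightarrow>
     (\<forall>f :: real \<Rightarrow> real. continuous_on UNIV f \<and> bounded (range f) \<longrightarrow>
        ((\<lambda>V. gc_state a1 a2 a3 \<beta> V (chem_pot a1 a2 a3 \<beta> V \<rho>) (\<lambda>c. f (real (total_num c) / V)))
          \<longlongrightarrow> integral\<^sup>L K f) at_top)"

end

theory Submission
  imports Defs
begin

text \<open>
  For every single volume and every mode, the canonical occupation number at \<open>n\<close> particles is at
  most four times the grand-canonical one at mean particle number \<open>n\<close>; the theorem follows by
  dividing by \<open>V\<close> and letting \<open>V\<close> tend to infinity.

  The canonical partition function \<open>Z(n)\<close> is the complete homogeneous symmetric function of the
  Boltzmann factors, and it is log-concave in \<open>n\<close>. Log-concavity is used twice. First, the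
  canonical occupation numbers \<open>D(n) / Z(n)\<close> satisfy \<open>D(n+1) = x (D(n) + Z(n))\<close>, hence increase
  with \<open>n\<close> because \<open>Z(n) / Z(n+1)\<close> does. Secondly, the grand-canonical law of the particle number is
  log-concave, so it puts mass at least \<open>1/4\<close> on \<open>{n..}\<close> when its mean is \<open>n\<close>. Discarding the
  particle numbers below \<open>n\<close> in the decomposition of the grand-canonical state into canonical ones
  gives the bound.
\<close>

section \<open>Log-concave sequences\<close>

definition log_concave_seq :: "(nat \<Rightarrow> real) \<Rightarrow> bool" where
  "log_concave_seq a \<longleftrightarrow> (\<forall>i. 0 \<le> a i) \<and> (\<forall>i j. i \<le> j \<longrightarrow> a i * a (Suc j) \<le> a (Suc i) * a j)"

lemma log_concave_seq_shift:
  assumes "log_concave_seq a" "i \<le> j"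
  shows "a i * a (j + d) \<le> a (i + d) * a j"
  using assms(2)
proof (induction d arbitrary: i)
  case 0
  then show ?case by simp
next
  case (Suc d)
  show ?case
  proof (cases "i = j")
    case True
    then show ?thesis by (simp add: mult.commute)
  next
    case False
    have "a i * a (Suc (j + d)) \<le> a (Suc i) * a (j + d)"
      using assms(1) Suc.prems unfolding log_concave_seq_def by simp
    also have "\<dots> \<le> a (Suc i + d) * a j"
      using Suc.IH[of "Suc i"] False Suc.prems by simp
    finally show ?thesis by simp
  qed
qed

text \<open>\<open>b\<close> is the convolution of \<open>a\<close> with 1, \<open>x\<close>,
  \<open>x ^ 2\<close>, ...: the effect on a partition function of one further mode with Boltzmann
  factor \<open>x\<close>.\<close>

lemma log_concave_seq_geometric_convolution:
  assumes a: "log_concave_seq a" and x: "0 \<le> x"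
    and b0: "b 0 = a 0" and bS: "\<And>n. b (Suc n) = a (Suc n) + x * b n"
  shows "log_concave_seq b"
proof -
  have a0: "0 \<le> a i" for i using a by (simp add: log_concave_seq_def)
  have b0': "0 \<le> b i" for i by (induction i) (simp_all add: b0 bS a0 x)
  have ab: "a i \<le> b i" for i by (cases i) (simp_all add: b0 bS b0' x)
  \<comment> \<open>With only one factor \<open>b\<close> on each side, induction on
    \<open>i\<close> works by expanding both \<open>b (Suc i)\<close> and \<open>b j\<close>. The
    induction raises \<open>d\<close>; in the end \<open>d = 1\<close> suffices, since the terms
    \<open>x * b i * b j\<close> cancel.\<close>
  have key: "b i * a (j + d) \<le> a (i + d) * b j" if "i \<le> j" for i j d
    using that
  proof (induction i arbitrary: j d)
    case 0
    have "a 0 * a (j + d) \<le> a (0 + d) * a j"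
      by (rule log_concave_seq_shift[OF a]) simp
    also have "\<dots> \<le> a (0 + d) * b j"
      by (intro mult_left_mono ab a0)
    finally show ?case by (simp add: b0)
  next
    case (Suc i)
    then obtain j' where j: "j = Suc j'" "i \<le> j'" by (cases j) auto
    have 1: "a (Suc i) * a (Suc j' + d) \<le> a (Suc i + d) * a (Suc j')"
      using log_concave_seq_shift[OF a, of "Suc i" "Suc j'" d] j by simp
    have 2: "x * (b i * a (j' + Suc d)) \<le> x * (a (i + Suc d) * b j')"
      using Suc.IH[OF j(2), of "Suc d"] x by (rule mult_left_mono)
    show ?case using 1 2 by (simp add: j bS algebra_simps)
  qed
  show ?thesis
    unfolding log_concave_seq_def
  proof (intro conjI allI impI b0')
    fix i j :: nat assume "i \<le> j"
    then show "b i * b (Suc j) \<le> b (Suc i) * b j"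
      using key[of i j 1] by (simp add: bS algebra_simps)
  qed
qed

text \<open>Summing log-concavity of \<open>p\<close> termwise gives
  \<open>p i * T (Suc i) \<le> p (Suc i) * T i\<close>; writing both values of \<open>p\<close> as
  differences of tails turns this into log-concavity of \<open>T\<close>.\<close>

lemma log_concave_seq_tail_sums:
  assumes lc: "log_concave_seq p" and pos: "\<And>i. 0 < p i" and sm: "summable p"
  defines "T \<equiv> \<lambda>i. \<Sum>k. p (k + i)"
  shows "T i = p i + T (Suc i)" "0 < T i" "T i * T (Suc (Suc i)) \<le> T (Suc i) * T (Suc i)"
proof -
  have sm': "summable (\<lambda>k. p (k + i))" for i using sm by (simp add: summable_iff_shift)
  show step: "T i = p i + T (Suc i)" for i
    using suminf_split_head[OF sm'[of i]] by (simp add: T_def)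
  show T0: "0 < T i" for i
    unfolding T_def using suminf_pos[OF sm' pos] .
  have "p i * T (Suc i) \<le> p (Suc i) * T i"
  proof -
    have "(\<Sum>k. p i * p (k + Suc i)) \<le> (\<Sum>k. p (Suc i) * p (k + i))"
    proof (intro suminf_le allI summable_mult sm')
      fix k show "p i * p (k + Suc i) \<le> p (Suc i) * p (k + i)"
        using lc by (simp add: log_concave_seq_def)
    qed
    then show ?thesis by (simp only: T_def suminf_mult[OF sm'])
  qed
  then show "T i * T (Suc (Suc i)) \<le> T (Suc i) * T (Suc i)"
    using step[of i] step[of "Suc i"] by (simp add: algebra_simps)
qed

text \<open>A discrete form of Gruenbaum's inequality. The tail sums \<open>T\<close> are log-concave, hence
  geometrically dominated by \<open>T n * s ^ j\<close> with the slope \<open>s\<close> at the mean \<open>n\<close>; if \<open>T n\<close> were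
  small, the deficit below the mean would exceed the excess above it.\<close>
lemma log_concave_seq_mass_above_mean:
  assumes lc: "log_concave_seq p" and pos: "\<And>i. 0 < p i" and sm: "summable p"
    and sm1: "summable (\<lambda>i. real i * p i)"
    and mean: "(\<Sum>i. (real i - real n) * p i) = 0"
  shows "suminf p \<le> 4 * (\<Sum>k. p (k + n))"
proof (rule ccontr)
  define T where "T = (\<lambda>i. \<Sum>k. p (k + i))"
  have ts: "T i = p i + T (Suc i)" "0 < T i" "T i * T (Suc (Suc i)) \<le> T (Suc i) * T (Suc i)" for i
    unfolding T_def by (fact log_concave_seq_tail_sums[OF lc pos sm])+
  assume "\<not> ?thesis"
  then have small: "4 * T n < T 0" by (simp add: T_def)
  \<comment> \<open>Tail ratios decrease, so \<open>s\<close> bounds later ratios from above and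
    earlier ones from below; this gives \<open>up\<close> and \<open>down\<close>.\<close>
  define s where "s = T (Suc n) / T n"
  have s0: "0 < s" using ts(2) by (simp add: s_def)
  have s1: "s < 1" using ts(1)[of n] ts(2)[of n] pos[of n] by (simp add: s_def divide_simps)
  have ratio_mono: "decseq (\<lambda>i. T (Suc i) / T i)"
  proof (rule decseq_SucI)
    fix i show "T (Suc (Suc i)) / T (Suc i) \<le> T (Suc i) / T i"
      using ts(3)[of i] ts(2)[of i] ts(2)[of "Suc i"] by (simp add: divide_simps mult.commute)
  qed
  have up: "T (n + j) \<le> T n * s ^ j" for j
  proof (induction j)
    case (Suc j)
    have "T (Suc (n + j)) / T (n + j) \<le> s"
      using decseqD[OF ratio_mono, of n "n + j"] by (simp add: s_def)
    then have "T (Suc (n + j)) \<le> s * T (n + j)"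
      using ts(2)[of "n + j"] by (simp add: divide_simps)
    also have "\<dots> \<le> s * (T n * s ^ j)"
      using Suc.IH s0 by (intro mult_left_mono) auto
    finally show ?case by (simp add: algebra_simps)
  qed simp
  have down: "T (n - j) * s ^ j \<le> T n" if "j \<le> n" for j
    using that
  proof (induction j)
    case (Suc j)
    then have e: "Suc (n - Suc j) = n - j" by simp
    have "s \<le> T (n - j) / T (n - Suc j)"
      using decseqD[OF ratio_mono, of "n - Suc j" n] e by (simp add: s_def)
    then have "s * T (n - Suc j) \<le> T (n - j)"
      using ts(2)[of "n - Suc j"] by (simp add: divide_simps)
    then have "s ^ j * (s * T (n - Suc j)) \<le> s ^ j * T (n - j)"
      using s0 by (intro mult_left_mono) auto
    also have "\<dots> \<le> T n" using Suc by (simp add: mult.commute)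
    finally show ?case by (simp add: algebra_simps)
  qed simp
  \<comment> \<open>The excess above the mean: Abel summation expresses its partial sums through
    \<open>T (n + Suc k)\<close>, up to a nonnegative boundary term, and \<open>up\<close> bounds
    these by a geometric series.\<close>
  have upper: "(\<Sum>k. real k * p (k + n)) \<le> T n / (1 - s)"
  proof (rule suminf_le_const)
    have "summable (\<lambda>k. real (k + n) * p (k + n))"
      using sm1 summable_iff_shift[of "\<lambda>i. real i * p i" n] by simp
    then have "summable (\<lambda>k. real (k + n) * p (k + n) - real n * p (k + n))"
      by (intro summable_diff summable_mult) (use sm in \<open>simp_all add: summable_iff_shift\<close>)
    then show "summable (\<lambda>k. real k * p (k + n))" by (simp add: algebra_simps)
    fix M
    have "(\<Sum>k<M. real k * p (k + n)) + real M * T (M + n) = (\<Sum>k<M. T (n + Suc k))"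
    proof (induction M)
      case (Suc M)
      have "real M * p (M + n) + real (Suc M) * T (Suc M + n) = real M * T (M + n) + T (n + Suc M)"
        using ts(1)[of "M + n"] by (simp add: algebra_simps)
      then show ?case using Suc by simp
    qed simp
    then have "(\<Sum>k<M. real k * p (k + n)) \<le> (\<Sum>k<M. T (n + Suc k))"
      using ts(2)[of "M + n"] by (smt (verit) mult_nonneg_nonneg of_nat_0_le_iff)
    also have "\<dots> \<le> (\<Sum>k<M. T n * s ^ k)"
    proof (rule sum_mono)
      fix k
      have "T (n + Suc k) \<le> T (n + k)" using ts(1)[of "n + k"] pos[of "n + k"] by simp
      then show "T (n + Suc k) \<le> T n * s ^ k" using up[of k] by simp
    qed
    also have "\<dots> = T n * (1 - s ^ M) / (1 - s)"
      using s1 by (simp add: sum_distrib_left[symmetric] sum_gp_strict)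
    also have "\<dots> \<le> T n / (1 - s)"
      using s0 s1 ts(2)[of n] by (intro divide_right_mono) (simp_all add: mult_left_le)
    finally show "(\<Sum>k<M. real k * p (k + n)) \<le> T n / (1 - s)" .
  qed
  \<comment> \<open>The deficit below the mean, again by Abel summation; the index is reversed so
    that \<open>j\<close> counts steps down from \<open>n\<close>.\<close>
  have lower: "(\<Sum>i<n. (real n - real i) * p i) = (\<Sum>j<n. T 0 - T (n - j))"
  proof -
    have T: "T 0 - T i = (\<Sum>k<i. p k)" for i
    proof (induction i)
      case (Suc i)
      then show ?case using ts(1)[of i] by simp
    qed simp
    have "(\<Sum>i<n. (real n - real i) * p i) = (\<Sum>i<n. \<Sum>k<Suc i. p k)"
    proof (induction n)
      case (Suc n)
      have "(\<Sum>i<Suc n. (real (Suc n) - real i) * p i)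
          = (\<Sum>i<Suc n. (real n - real i) * p i) + (\<Sum>i<Suc n. p i)"
        by (simp add: sum.distrib[symmetric] algebra_simps)
      then show ?case using Suc by simp
    qed simp
    also have "\<dots> = (\<Sum>j<n. \<Sum>k<Suc (n - Suc j). p k)"
      by (subst sum.nat_diff_reindex[symmetric]) simp
    also have "\<dots> = (\<Sum>j<n. T 0 - T (n - j))"
      by (intro sum.cong) (simp_all add: T Suc_diff_Suc del: sum.lessThan_Suc)
    finally show ?thesis .
  qed
  have balance: "(\<Sum>i<n. (real n - real i) * p i) = (\<Sum>k. real k * p (k + n))"
  proof -
    have sd: "summable (\<lambda>i. (real i - real n) * p i)"
      using summable_diff[OF sm1 summable_mult[OF sm, of "real n"]] by (simp add: algebra_simps)
    show ?thesis
    proof -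
      have "(\<Sum>i<n. (real n - real i) * p i) = - (\<Sum>i<n. (real i - real n) * p i)"
        unfolding sum_negf[symmetric] by (intro sum.cong) (simp_all add: algebra_simps)
      then show ?thesis
        using suminf_split_initial_segment[OF sd, of n] mean by simp
    qed
  qed
  \<comment> \<open>Chosen so that, by \<open>down\<close>, \<open>q < s ^ j\<close> forces
    \<open>T (n - j) \<le> T 0 / 2\<close>.\<close>
  define q where "q = 2 * T n / T 0"
  have q: "q < 1 / 2" using small ts(2)[of 0] by (simp add: q_def divide_simps)
  have "s ^ n \<le> q"
    using down[of n] ts(2)[of 0] ts(2)[of n] by (simp add: q_def divide_simps algebra_simps)
  \<comment> \<open>Each level \<open>j < k\<close> contributes at least \<open>T 0 / 2\<close> to
    the deficit; \<open>s ^ n \<le> q\<close> keeps \<open>k\<close> at most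
    \<open>n\<close>.\<close>
  define k where "k = (LEAST k. s ^ k \<le> q)"
  have k: "s ^ k \<le> q" unfolding k_def using \<open>s ^ n \<le> q\<close> by (rule LeastI)
  have kn: "k \<le> n" unfolding k_def using \<open>s ^ n \<le> q\<close> by (rule Least_le)
  have half: "T 0 / 2 \<le> T 0 - T (n - j)" if "j < k" for j
  proof -
    have "q < s ^ j" using not_less_Least[of j "\<lambda>k. s ^ k \<le> q"] that by (simp add: k_def)
    then have "2 * T n < T 0 * s ^ j" using ts(2)[of 0] by (simp add: q_def divide_simps mult.commute)
    moreover have "T (n - j) * s ^ j \<le> T n" using down kn that by simp
    ultimately have "2 * T (n - j) * s ^ j < T 0 * s ^ j" by simp
    then show ?thesis using s0 by simp
  qed
  \<comment> \<open>Bernoulli turns \<open>s ^ k < 1 / 2\<close> into a lower bound for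
    \<open>k\<close> of order \<open>1 / (1 - s)\<close>.\<close>
  have "1 + real k * (s - 1) \<le> s ^ k"
    using Bernoulli_inequality[of "s - 1" k] s0 by simp
  then have "1 / 2 < real k * (1 - s)" using k q by (simp add: algebra_simps)
  then have k2: "1 / (2 * (1 - s)) < real k" using s1 by (simp add: divide_simps) (simp add: algebra_simps)
  have dec: "0 \<le> T 0 - T i" for i
  proof -
    have "T (Suc i) \<le> T i" for i using ts(1)[of i] pos[of i] by simp
    then have "decseq T" by (rule decseq_SucI)
    then show ?thesis using decseqD[of T 0 i] by simp
  qed
  \<comment> \<open>More than \<open>1 / (2 * (1 - s))\<close> levels worth \<open>T 0 / 2\<close>
    each face an excess of at most \<open>T n / (1 - s)\<close>; hence the constant 4.\<close>
  have "T 0 / (4 * (1 - s)) = 1 / (2 * (1 - s)) * (T 0 / 2)" by simp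
  also have "\<dots> < real k * (T 0 / 2)" using k2 ts(2)[of 0] by (intro mult_strict_right_mono) auto
  also have "\<dots> = (\<Sum>j<k. T 0 / 2)" by simp
  also have "\<dots> \<le> (\<Sum>j<k. T 0 - T (n - j))" using half by (intro sum_mono) auto
  also have "\<dots> \<le> (\<Sum>j<n. T 0 - T (n - j))" using kn dec by (intro sum_mono2) auto
  also have "\<dots> \<le> T n / (1 - s)" using upper balance lower by simp
  finally have "T 0 / 4 / (1 - s) < T n / (1 - s)" by (simp only: divide_divide_eq_left)
  then have "T 0 / 4 < T n" using s1 by (subst (asm) divide_less_cancel) auto
  with small show False by simp
qed

text \<open>Drop the terms below \<open>n\<close>, replace \<open>C i\<close> by the smaller
  \<open>C n\<close> in the others, and apply the mass bound.\<close>

lemma log_concave_seq_value_at_mean_le: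
  assumes lc: "log_concave_seq p" and pos: "\<And>i. 0 < p i" and sm: "summable p"
    and sm1: "summable (\<lambda>i. real i * p i)"
    and mean: "(\<Sum>i. (real i - real n) * p i) = 0"
    and C0: "\<And>i. 0 \<le> C i" and C: "incseq C" and smC: "summable (\<lambda>i. C i * p i)"
  shows "C n * suminf p \<le> 4 * (\<Sum>i. C i * p i)"
proof -
  have sm': "summable (\<lambda>k. p (k + n))" using sm by (simp add: summable_iff_shift)
  have smC': "summable (\<lambda>k. C (k + n) * p (k + n))"
    using smC summable_iff_shift[of "\<lambda>i. C i * p i" n] by simp
  have "C n * suminf p \<le> C n * (4 * (\<Sum>k. p (k + n)))"
    by (intro mult_left_mono C0 log_concave_seq_mass_above_mean[OF lc pos sm sm1 mean])
  also have "\<dots> = 4 * (\<Sum>k. C n * p (k + n))" using suminf_mult[OF sm', of "C n"] by simp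
  also have "(\<Sum>k. C n * p (k + n)) \<le> (\<Sum>k. C (k + n) * p (k + n))"
    by (intro suminf_le summable_mult sm' smC' mult_right_mono incseqD[OF C])
      (simp_all add: less_imp_le pos)
  also have "\<dots> \<le> (\<Sum>i. C i * p i)"
    using suminf_split_initial_segment[OF smC, of n] C0 pos
    by (simp add: sum_nonneg less_imp_le)
  finally show ?thesis by simp
qed

section \<open>Power series with prescribed tilted mean\<close>

text \<open>For \<open>z = y * r\<close> with \<open>r > 1\<close>, subtracting \<open>r ^ n\<close>
  times the series at \<open>y\<close> from that at \<open>z\<close> leaves terms
  \<open>(i - n) * (r ^ i - r ^ n) * a i * y ^ i\<close>. They are nonnegative because both
  differences have the same sign, so a zero sum kills them all; yet the term at 0 is
  positive.\<close>

lemma powser_tilted_mean_unique: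
  fixes a :: "nat \<Rightarrow> real"
  assumes pos: "\<And>i. 0 < a i" and n: "0 < n" and y: "0 < y" and z: "0 < z"
    and smy: "summable (\<lambda>i. (real i - real n) * (a i * y ^ i))"
    and smz: "summable (\<lambda>i. (real i - real n) * (a i * z ^ i))"
    and my: "(\<Sum>i. (real i - real n) * (a i * y ^ i)) = 0"
    and mz: "(\<Sum>i. (real i - real n) * (a i * z ^ i)) = 0"
  shows "y = z"
proof -
  have False if "y < z" "0 < y"
    and smy: "summable (\<lambda>i. (real i - real n) * (a i * y ^ i))"
    and smz: "summable (\<lambda>i. (real i - real n) * (a i * z ^ i))"
    and my: "(\<Sum>i. (real i - real n) * (a i * y ^ i)) = 0"
    and mz: "(\<Sum>i. (real i - real n) * (a i * z ^ i)) = 0" for y z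
  proof -
    define r where "r = z / y"
    have r: "1 < r" "z = y * r" using that by (simp_all add: r_def divide_simps)
    define f where "f i = (real i - real n) * (a i * z ^ i)
        - r ^ n * ((real i - real n) * (a i * y ^ i))" for i
    have f: "f i = (real i - real n) * (r ^ i - r ^ n) * (a i * y ^ i)" for i
      by (simp add: f_def r(2) power_mult_distrib algebra_simps)
    have smf: "summable f" unfolding f_def by (intro summable_diff summable_mult smy smz)
    have "suminf f = 0"
      unfolding f_def using suminf_diff[OF smz summable_mult[OF smy]] suminf_mult[OF smy] my mz
      by simp
    moreover have nn: "0 \<le> f i" for i
    proof (cases "i \<le> n")
      case True
      then have "r ^ i \<le> r ^ n" using r by (intro power_increasing) auto
      then show ?thesis
        using True pos[of i] \<open>0 < y\<close>
        by (simp add: f mult_nonpos_nonpos mult_nonneg_nonneg less_imp_le)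
    next
      case False
      then have "r ^ n \<le> r ^ i" using r by (intro power_increasing) auto
      then show ?thesis
        using False pos[of i] \<open>0 < y\<close> by (auto simp: f intro!: mult_nonneg_nonneg)
    qed
    ultimately have "f 0 = 0" using suminf_eq_zero_iff[OF smf] by simp
    moreover have "1 < r ^ n" using r n by (simp add: one_less_power)
    ultimately show False using pos[of 0] n by (auto simp: f)
  qed
  from this[of y z] this[of z y] show ?thesis using assms by (metis linorder_neqE_linordered_idom)
qed

text \<open>Intermediate value theorem: the series is negative at 0 and, as the terms
  \<open>a i * R ^ i\<close> stay at least 1, positive close to \<open>R\<close>.\<close>

lemma powser_tilted_mean_exists:
  fixes a :: "nat \<Rightarrow> real"
  assumes R: "0 < R" and n: "0 < n" and ge: "\<And>i. 1 \<le> a i * R ^ i"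
    and sm: "\<And>z. 0 \<le> z \<Longrightarrow> z < R \<Longrightarrow> summable (\<lambda>i. (real i - real n) * (a i * z ^ i))"
  obtains z where "0 < z" "z < R" "(\<Sum>i. (real i - real n) * (a i * z ^ i)) = 0"
proof -
  define c where "c i = (real i - real n) * a i" for i
  define H where "H z = (\<Sum>i. c i * z ^ i)" for z
  have smc: "summable (\<lambda>i. c i * z ^ i)" if "0 \<le> z" "z < R" for z
    using sm[OF that] by (simp add: c_def mult.assoc)
  have pos: "0 < a i" for i
  proof -
    have "0 < a i * R ^ i" using ge[of i] by simp
    then show ?thesis using R by (simp add: zero_less_mult_iff)
  qed
  have H0: "H 0 < 0"
    using pos[of 0] n by (simp add: H_def c_def mult_neg_pos)
  \<comment> \<open>\<open>D\<close> bounds the negative part from indices below \<open>n\<close>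
    for every \<open>z < R\<close>; more than \<open>2 * D\<close> indices above \<open>n\<close>,
    contributing at least 1/2 each, outweigh it.\<close>
  define D where "D = (\<Sum>i<n. real n * (a i * R ^ i))"
  obtain M :: nat where M: "2 * D < real M" using reals_Archimedean2 by blast
  \<comment> \<open>By Bernoulli this is close enough to 1 that \<open>t ^ i\<close> stays at least
    1/2 up to \<open>i = n + M\<close>.\<close>
  define t :: real where "t = 1 - 1 / (2 * real (n + M + 1))"
  have t: "0 < t" "t < 1" by (simp_all add: t_def divide_simps)
  have th: "1 / 2 \<le> t ^ i" if "i \<le> n + M" for i
  proof -
    have "1 / 2 \<le> 1 + real i * (t - 1)" using that by (simp add: t_def divide_simps)
    also have "\<dots> \<le> t ^ i" using Bernoulli_inequality[of "t - 1" i] t by simp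
    finally show ?thesis .
  qed
  define z where "z = t * R"
  have z: "0 < z" "z < R" using t R by (simp_all add: z_def)
  have azi: "a i * z ^ i = (a i * R ^ i) * t ^ i" for i
    by (simp add: z_def power_mult_distrib)
  have azi0: "0 < a i * z ^ i" for i using pos z by simp
  have "D < real M * (1 / 2)" using M by simp
  also have "\<dots> = (\<Sum>k = Suc n..n + M. 1 / 2)" by simp
  also have "\<dots> \<le> (\<Sum>i = Suc n..n + M. c i * z ^ i)"
  proof (rule sum_mono)
    fix i assume i: "i \<in> {Suc n..n + M}"
    have "1 / 2 \<le> (a i * R ^ i) * t ^ i"
      using mult_mono[OF ge[of i] th[of i]] i ge[of i] by simp
    also have "\<dots> \<le> (real i - real n) * ((a i * R ^ i) * t ^ i)"
      using mult_right_mono[of 1 "real i - real n" "a i * R ^ i * t ^ i"] i azi0[of i]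
      unfolding azi by simp
    finally show "1 / 2 \<le> c i * z ^ i" by (simp add: c_def azi mult.assoc)
  qed
  also have "\<dots> \<le> (\<Sum>k. c (k + n) * z ^ (k + n))"
  proof -
    have s: "summable (\<lambda>k. c (k + n) * z ^ (k + n))"
      using smc[of z] z summable_iff_shift[of "\<lambda>i. c i * z ^ i" n] by simp
    have "(\<Sum>i = Suc n..n + M. c i * z ^ i) = (\<Sum>k \<in> {1..M}. c (k + n) * z ^ (k + n))"
      using sum.shift_bounds_cl_nat_ivl[of "\<lambda>i. c i * z ^ i" 1 n M] by (simp add: add.commute)
    also have "\<dots> \<le> (\<Sum>k. c (k + n) * z ^ (k + n))"
      using azi0 by (intro sum_le_suminf s) (auto simp: c_def mult.assoc less_imp_le)
    finally show ?thesis .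
  qed
  finally have up: "D < (\<Sum>k. c (k + n) * z ^ (k + n))" .
  have "- D \<le> (\<Sum>i<n. c i * z ^ i)"
    unfolding D_def sum_negf[symmetric]
  proof (rule sum_mono)
    fix i assume "i \<in> {..<n}"
    have "(real n - real i) * (a i * z ^ i) \<le> real n * (a i * R ^ i)"
      using azi0[of i] pos[of i] z \<open>i \<in> {..<n}\<close>
      by (intro mult_mono) (auto intro!: mult_left_mono power_mono)
    then show "- (real n * (a i * R ^ i)) \<le> c i * z ^ i" by (simp add: c_def algebra_simps)
  qed
  then have Hz: "0 < H z"
    using up suminf_split_initial_segment[OF smc[of z], of n] z by (simp add: H_def)
  have cont: "\<forall>y. 0 \<le> y \<and> y \<le> z \<longrightarrow> isCont H y"
  proof (intro allI impI)
    fix y assume y: "0 \<le> y \<and> y \<le> z"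
    \<comment> \<open>Continuity needs convergence at a point strictly beyond \<open>y\<close>; the
      midpoint of \<open>z\<close> and \<open>R\<close> serves.\<close>
    show "isCont H y"
      unfolding H_def using isCont_powser[OF smc[of "(z + R) / 2"], of y] y z by simp
  qed
  obtain y where y: "0 \<le> y" "y \<le> z" "H y = 0"
    using IVT[of H 0 0 z] H0 Hz cont z by auto
  show ?thesis
  proof (rule that)
    show "0 < y" using y H0 by (cases "y = 0") auto
    show "y < R" using y z by simp
    show "(\<Sum>i. (real i - real n) * (a i * y ^ i)) = 0"
      using y by (simp add: H_def c_def mult.assoc)
  qed
qed

section \<open>Canonical partition functions\<close>

definition confs :: "mode set \<Rightarrow> nat \<Rightarrow> occ set" where
  "confs A n = {c. finite (supp_occ c) \<and> supp_occ c \<subseteq> A \<and> total_num c = n}"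

definition occ_weight :: "(mode \<Rightarrow> real) \<Rightarrow> occ \<Rightarrow> real" where
  "occ_weight x c = (\<Prod>m\<in>supp_occ c. x m ^ c m)"

definition add_particle :: "mode \<Rightarrow> occ \<Rightarrow> occ" where
  "add_particle m c = c(m := Suc (c m))"

text \<open>The complete homogeneous symmetric function of degree \<open>n\<close> in the variables
  \<open>x m\<close> with \<open>m \<in> A\<close>; keeping \<open>A\<close> variable permits
  induction over modes.\<close>

definition canonical_part :: "(mode \<Rightarrow> real) \<Rightarrow> mode set \<Rightarrow> nat \<Rightarrow> real" where
  "canonical_part x A n = infsum (occ_weight x) (confs A n)"

lemma supp_add_particle [simp]: "supp_occ (add_particle m c) = insert m (supp_occ c)"
  by (auto simp: supp_occ_def add_particle_def)

lemma add_particle_same [simp]: "add_particle m c m = Suc (c m)"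
  by (simp add: add_particle_def)

lemma inj_add_particle: "inj (add_particle m)"
proof (rule injI, rule ext)
  fix c d i assume "add_particle m c = add_particle m d"
  then have "add_particle m c i = add_particle m d i" by simp
  then show "c i = d i" by (simp add: add_particle_def split: if_splits)
qed

lemma total_num_superset:
  assumes "finite S" "supp_occ c \<subseteq> S"
  shows "total_num c = sum c S"
  unfolding total_num_def using assms by (intro sum.mono_neutral_left) (auto simp: supp_occ_def)

lemma occ_weight_superset:
  assumes "finite S" "supp_occ c \<subseteq> S"
  shows "occ_weight x c = (\<Prod>m\<in>S. x m ^ c m)"
  unfolding occ_weight_def using assms by (intro prod.mono_neutral_left) (auto simp: supp_occ_def)

lemma total_num_add_particle:
  assumes "finite (supp_occ c)"
  shows "total_num (add_particle m c) = Suc (total_num c)"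
proof -
  let ?S = "insert m (supp_occ c)"
  have f: "finite ?S" using assms by simp
  have "total_num (add_particle m c) = Suc (c m) + sum (add_particle m c) (?S - {m})"
    using total_num_superset[OF f, of "add_particle m c"] sum.remove[OF f, of m "add_particle m c"]
    by simp
  also have "sum (add_particle m c) (?S - {m}) = sum c (?S - {m})"
    by (intro sum.cong) (auto simp: add_particle_def)
  also have "Suc (c m) + \<dots> = Suc (total_num c)"
    using total_num_superset[OF f subset_insertI] sum.remove[OF f, of m c] by simp
  finally show ?thesis .
qed

lemma occ_weight_add_particle:
  assumes "finite (supp_occ c)"
  shows "occ_weight x (add_particle m c) = x m * occ_weight x c"
proof -
  let ?S = "insert m (supp_occ c)"
  let ?f = "\<lambda>c i. x i ^ c i :: real"
  have f: "finite ?S" using assms by simp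
  have "occ_weight x (add_particle m c) = x m ^ Suc (c m) * prod (?f (add_particle m c)) (?S - {m})"
    using occ_weight_superset[OF f, of "add_particle m c" x]
      prod.remove[OF f, of m "?f (add_particle m c)"] by simp
  also have "prod (?f (add_particle m c)) (?S - {m}) = prod (?f c) (?S - {m})"
    by (intro prod.cong) (auto simp: add_particle_def)
  also have "x m ^ Suc (c m) * \<dots> = x m * occ_weight x c"
    using occ_weight_superset[OF f subset_insertI, of x] prod.remove[OF f, of m "?f c"] by simp
  finally show ?thesis .
qed

text \<open>Removing a particle from \<open>m\<close> inverts \<open>add_particle m\<close>; this
  correspondence underlies the recursions in the particle number.\<close>

lemma occupied_confs_conv_add_particle:
  assumes "m \<in> A"
  shows "{c \<in> confs A (Suc n). c m \<noteq> 0} = add_particle m ` confs A n"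
proof (intro equalityI subsetI)
  fix c assume c: "c \<in> {c \<in> confs A (Suc n). c m \<noteq> 0}"
  define d where "d = c(m := c m - 1)"
  have cd: "c = add_particle m d" using c by (auto simp: d_def add_particle_def)
  have "supp_occ d \<subseteq> supp_occ c" by (auto simp: d_def supp_occ_def)
  then have fd: "finite (supp_occ d)" "supp_occ d \<subseteq> A"
    using c by (auto simp: confs_def intro: finite_subset)
  moreover have "total_num d = n"
    using total_num_add_particle[OF fd(1), of m] c cd by (simp add: confs_def)
  ultimately show "c \<in> add_particle m ` confs A n" using cd by (auto simp: confs_def)
next
  fix c assume "c \<in> add_particle m ` confs A n"
  then show "c \<in> {c \<in> confs A (Suc n). c m \<noteq> 0}"
    using assms by (auto simp: confs_def total_num_add_particle)
qed

lemma confs_0: "confs A 0 = {\<lambda>_. 0}"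
proof -
  have "c = (\<lambda>_. 0)" if "c \<in> confs A 0" for c
    using that by (auto simp: confs_def total_num_def supp_occ_def)
  moreover have "(\<lambda>_. 0) \<in> confs A 0" by (simp add: confs_def total_num_def supp_occ_def)
  ultimately show ?thesis by blast
qed

text \<open>Remove a particle from any occupied mode. There is one preimage per occupied mode, an
  overcount that is harmless for upper bounds.\<close>

lemma confs_Suc_subset: "confs A (Suc n) \<subseteq> (\<lambda>(m, c). add_particle m c) ` (A \<times> confs A n)"
proof
  fix c assume c: "c \<in> confs A (Suc n)"
  then have "supp_occ c \<noteq> {}" by (auto simp: confs_def total_num_def)
  then obtain m where m: "c m \<noteq> 0" "m \<in> supp_occ c" by (auto simp: supp_occ_def)
  then have "m \<in> A" using c by (auto simp: confs_def)
  then have "c \<in> add_particle m ` confs A n"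
    using occupied_confs_conv_add_particle[of m A n] c m by auto
  then show "c \<in> (\<lambda>(m, c). add_particle m c) ` (A \<times> confs A n)" using \<open>m \<in> A\<close> by auto
qed

lemma confs_mono: "A \<subseteq> B \<Longrightarrow> confs A n \<subseteq> confs B n"
  by (auto simp: confs_def)

lemma occ_le_total_num:
  assumes "finite (supp_occ c)"
  shows "c m \<le> total_num c"
proof -
  have "c m \<le> sum c (insert m (supp_occ c))"
    using assms by (intro member_le_sum) auto
  then show ?thesis using total_num_superset[OF _ subset_insertI[of "supp_occ c" m]] assms by simp
qed

section \<open>Convergence and recursion of the canonical partition functions\<close>

locale boson_modes =
  fixes x :: "mode \<Rightarrow> real"
  assumes x_pos: "\<And>m. 0 < x m" and x_summable: "x summable_on UNIV"
begin

abbreviation "w \<equiv> occ_weight x"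
abbreviation "Z \<equiv> canonical_part x"

lemma w_pos: "0 < w c"
  unfolding occ_weight_def by (intro prod_pos ballI zero_less_power x_pos)

lemma x_summable_on: "x summable_on A"
  using x_summable by (rule summable_on_subset) simp

text \<open>\<open>G\<close> keeps one pair (mode, configuration) per configuration with one more
  particle, so the new sum is a sub-sum of the product \<open>infsum x A * Z A n\<close>.\<close>

lemma confs_Suc_summable:
  assumes "w summable_on confs A n"
  shows "w summable_on confs A (Suc n)" "Z A (Suc n) \<le> infsum x A * Z A n"
proof -
  let ?f = "\<lambda>(m, c). x m * w c"
  let ?P = "A \<times> confs A n"
  let ?h = "\<lambda>(m, c). add_particle m c"
  have inner: "((\<lambda>c. ?f (m, c)) has_sum x m * Z A n) (confs A n)" for m
    unfolding canonical_part_def using assms by (simp add: has_sum_cmult_right)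
  have outer: "((\<lambda>m. x m * Z A n) has_sum infsum x A * Z A n) A"
    by (intro has_sum_cmult_left has_sum_infsum x_summable_on)
  have sP: "?f summable_on ?P"
    by (rule summable_on_SigmaI[OF inner has_sum_imp_summable[OF outer]])
      (simp_all add: less_imp_le x_pos w_pos)
  have hP: "(?f has_sum infsum x A * Z A n) ?P"
    by (rule has_sum_SigmaI[OF inner outer sP])
  obtain G where G: "G \<subseteq> ?P" "bij_betw ?h G (confs A (Suc n))"
    using confs_Suc_subset[of A n] subset_image_inj[of "confs A (Suc n)" ?h ?P]
    by (auto simp: bij_betw_def)
  have wh: "w (?h q) = ?f q" if "q \<in> G" for q
    using that G(1) by (auto simp: confs_def occ_weight_add_particle)
  have sG: "?f summable_on G" using sP G(1) by (rule summable_on_subset)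
  have "((\<lambda>q. w (?h q)) has_sum infsum ?f G) G"
    using sG wh by (subst has_sum_cong[of _ _ ?f]) auto
  then have *: "(w has_sum infsum ?f G) (confs A (Suc n))"
    using has_sum_reindex_bij_betw[OF G(2)] by blast
  then show "w summable_on confs A (Suc n)" by (rule has_sum_imp_summable)
  have "infsum ?f G \<le> infsum x A * Z A n"
    by (rule has_sum_mono2[OF has_sum_infsum[OF sG] hP G(1)])
      (auto simp: less_imp_le x_pos w_pos)
  then show "Z A (Suc n) \<le> infsum x A * Z A n"
    using * by (simp add: canonical_part_def infsumI)
qed

lemma w_summable: "w summable_on confs A n"
  by (induction n) (simp_all add: confs_0 confs_Suc_summable)

lemma w_has_sum: "(w has_sum Z A n) (confs A n)"
  unfolding canonical_part_def by (rule has_sum_infsum[OF w_summable])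

lemma canonical_part_0 [simp]: "Z A 0 = 1"
  by (simp add: canonical_part_def confs_0 occ_weight_def supp_occ_def)

lemma canonical_part_nonneg: "0 \<le> Z A n"
  unfolding canonical_part_def by (intro infsum_nonneg less_imp_le w_pos)

lemma canonical_part_le_power: "Z A n \<le> infsum x A ^ n"
proof (induction n)
  case (Suc n)
  have "Z A (Suc n) \<le> infsum x A * Z A n" by (rule confs_Suc_summable(2)[OF w_summable])
  also have "\<dots> \<le> infsum x A * infsum x A ^ n"
    by (intro mult_left_mono Suc infsum_nonneg less_imp_le x_pos)
  finally show ?case by simp
qed simp

lemma canonical_part_mono:
  assumes "A \<subseteq> B"
  shows "Z A n \<le> Z B n"
  by (rule has_sum_mono2[OF w_has_sum w_has_sum confs_mono[OF assms]]) (simp add: less_imp_le w_pos)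

lemma occupied_has_sum:
  assumes "m \<in> A" and "((\<lambda>c. F (add_particle m c) * w c) has_sum S) (confs A n)"
  shows "((\<lambda>c. F c * w c) has_sum x m * S) {c \<in> confs A (Suc n). c m \<noteq> 0}"
proof -
  have bij: "bij_betw (add_particle m) (confs A n) {c \<in> confs A (Suc n). c m \<noteq> 0}"
    using inj_add_particle occupied_confs_conv_add_particle[OF assms(1)]
    by (simp add: bij_betw_def inj_on_subset[OF inj_add_particle])
  have "((\<lambda>c. x m * (F (add_particle m c) * w c)) has_sum x m * S) (confs A n)"
    using assms(2) by (rule has_sum_cmult_right)
  then have "((\<lambda>c. F (add_particle m c) * w (add_particle m c)) has_sum x m * S) (confs A n)"
    by (rule has_sum_cong[THEN iffD1, rotated]) (simp add: confs_def occ_weight_add_particle)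
  then show ?thesis using has_sum_reindex_bij_betw[OF bij] by blast
qed

text \<open>Split by whether \<open>m\<close> is occupied. After one particle is taken out,
  \<open>m\<close> may still be occupied, hence \<open>insert m A\<close> in the last term.\<close>

lemma canonical_part_insert_mode:
  assumes "m \<notin> A"
  shows "Z (insert m A) (Suc n) = Z A (Suc n) + x m * Z (insert m A) n"
proof -
  let ?B = "insert m A"
  have e: "confs ?B (Suc n) = confs A (Suc n) \<union> {c \<in> confs ?B (Suc n). c m \<noteq> 0}"
    using assms by (auto simp: confs_def supp_occ_def)
  have d: "confs A (Suc n) \<inter> {c \<in> confs ?B (Suc n). c m \<noteq> 0} = {}"
    using assms by (auto simp: confs_def supp_occ_def)
  have "(w has_sum x m * Z ?B n) {c \<in> confs ?B (Suc n). c m \<noteq> 0}"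
    using occupied_has_sum[of m ?B "\<lambda>_. 1" n "Z ?B n"] w_has_sum[of ?B n] by simp
  then have "(w has_sum Z A (Suc n) + x m * Z ?B n) (confs ?B (Suc n))"
    by (subst e) (rule has_sum_Un_disjoint[OF w_has_sum _ d])
  then show ?thesis using w_has_sum has_sum_unique by blast
qed

section \<open>Log-concavity, first for finitely many modes and then in the limit\<close>

lemma log_concave_finite_modes:
  assumes "finite A"
  shows "log_concave_seq (Z A)"
  using assms
proof (induction A rule: finite_induct)
  case empty
  have "confs {} (Suc n) = {}" for n
    by (auto simp: confs_def total_num_def)
  then have "Z {} (Suc n) = 0" for n by (simp add: canonical_part_def)
  then show ?case by (auto simp: log_concave_seq_def canonical_part_nonneg)
next
  case (insert m A)
  show ?case
    by (rule log_concave_seq_geometric_convolution[OF insert.IH, of "x m"])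
      (simp_all add: less_imp_le x_pos canonical_part_insert_mode insert.hyps)
qed

text \<open>From below: finitely many configurations occupy finitely many modes, so a large finite
  \<open>F\<close> counts them all. From above: monotonicity in the mode set.\<close>

lemma canonical_part_tendsto:
  "((\<lambda>F. Z F n) \<longlongrightarrow> Z UNIV n) (finite_subsets_at_top UNIV)"
proof (rule order_tendstoI)
  fix a assume "a < Z UNIV n"
  moreover have "(sum w \<longlongrightarrow> Z UNIV n) (finite_subsets_at_top (confs UNIV n))"
    using w_has_sum by (simp add: has_sum_def)
  ultimately have "\<forall>\<^sub>F G in finite_subsets_at_top (confs UNIV n). a < sum w G"
    by (simp add: order_tendstoD)
  then obtain G where G: "finite G" "G \<subseteq> confs UNIV n" "a < sum w G"
    by (auto simp: eventually_finite_subsets_at_top)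
  show "\<forall>\<^sub>F F in finite_subsets_at_top UNIV. a < Z F n"
    unfolding eventually_finite_subsets_at_top
  proof (intro exI[of _ "\<Union>c\<in>G. supp_occ c"] conjI allI impI)
    show "finite (\<Union>c\<in>G. supp_occ c)" using G by (auto simp: confs_def)
    fix F :: "mode set" assume F: "finite F \<and> (\<Union>c\<in>G. supp_occ c) \<subseteq> F \<and> F \<subseteq> UNIV"
    then have "G \<subseteq> confs F n" using G by (auto simp: confs_def)
    then have "sum w G \<le> Z F n"
      unfolding canonical_part_def using G(1)
      by (intro finite_sum_le_infsum w_summable) (auto simp: less_imp_le w_pos)
    then show "a < Z F n" using G by simp
  qed simp
next
  fix a assume "Z UNIV n < a"
  then have "Z F n < a" for F using canonical_part_mono[of F UNIV n] by simp
  then show "\<forall>\<^sub>F F in finite_subsets_at_top UNIV. Z F n < a" by simp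
qed

lemma log_concave_canonical_part: "log_concave_seq (Z UNIV)"
  unfolding log_concave_seq_def
proof (intro conjI allI impI canonical_part_nonneg)
  fix i j :: nat assume "i \<le> j"
  show "Z UNIV i * Z UNIV (Suc j) \<le> Z UNIV (Suc i) * Z UNIV j"
  proof (rule tendsto_le[OF finite_subsets_at_top_neq_bot])
    show "((\<lambda>F. Z F (Suc i) * Z F j) \<longlongrightarrow> Z UNIV (Suc i) * Z UNIV j) (finite_subsets_at_top UNIV)"
      by (intro tendsto_mult canonical_part_tendsto)
    show "((\<lambda>F. Z F i * Z F (Suc j)) \<longlongrightarrow> Z UNIV i * Z UNIV (Suc j)) (finite_subsets_at_top UNIV)"
      by (intro tendsto_mult canonical_part_tendsto)
    show "\<forall>\<^sub>F F in finite_subsets_at_top UNIV. Z F i * Z F (Suc j) \<le> Z F (Suc i) * Z F j"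
    proof (rule eventually_finite_subsets_at_top_weakI)
      fix F :: "mode set" assume "finite F"
      then show "Z F i * Z F (Suc j) \<le> Z F (Suc i) * Z F j"
        using log_concave_finite_modes \<open>i \<le> j\<close> by (simp add: log_concave_seq_def)
    qed
  qed
qed

text \<open>The bound is the weight of the configuration with all \<open>n\<close> particles in
  \<open>m\<close>. For the ground mode it keeps the terms of the grand-canonical series at least 1
  at the threshold fugacity.\<close>

lemma canonical_part_ge_power: "x m ^ n \<le> Z UNIV n"
proof (induction n)
  case (Suc n)
  have "x m * x m ^ n \<le> x m * Z UNIV n" using Suc x_pos[of m] by simp
  also have "\<dots> \<le> Z UNIV (Suc n)"
    using canonical_part_insert_mode[of m "UNIV - {m}" n] canonical_part_nonneg[of "UNIV - {m}" "Suc n"]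
    by (simp add: insert_UNIV insert_absorb)
  finally show ?case by simp
qed simp

lemma canonical_part_pos: "0 < Z UNIV n"
  using canonical_part_ge_power[where m = undefined and n = n] x_pos[of undefined]
  by (meson less_le_trans zero_less_power)

section \<open>Canonical occupation numbers\<close>

definition occ_sum :: "mode \<Rightarrow> nat \<Rightarrow> real" where
  "occ_sum m n = infsum (\<lambda>c. real (c m) * w c) (confs UNIV n)"

lemma occ_has_sum: "((\<lambda>c. real (c m) * w c) has_sum occ_sum m n) (confs UNIV n)"
proof -
  have "(\<lambda>c. real (c m) * w c) summable_on confs UNIV n"
  proof (rule summable_on_comparison_test)
    show "(\<lambda>c. real n * w c) summable_on confs UNIV n"
      by (rule summable_on_cmult_right[OF w_summable])
    show "real (c m) * w c \<le> real n * w c" "0 \<le> real (c m) * w c" if "c \<in> confs UNIV n" for c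
      using that occ_le_total_num[of c m] w_pos[of c] by (auto simp: confs_def)
  qed
  then show ?thesis by (simp add: occ_sum_def)
qed

lemma occ_sum_0 [simp]: "occ_sum m 0 = 0"
  by (simp add: occ_sum_def confs_0)

text \<open>Configurations with \<open>m\<close> empty contribute nothing. The others arise by
  adding a particle to \<open>m\<close>, which raises its occupation by one and so yields the
  summand \<open>Z UNIV n\<close>.\<close>

lemma occ_sum_Suc: "occ_sum m (Suc n) = x m * (occ_sum m n + Z UNIV n)"
proof -
  have "((\<lambda>c. real (add_particle m c m) * w c) has_sum occ_sum m n + Z UNIV n) (confs UNIV n)"
    using has_sum_add[OF occ_has_sum w_has_sum, of m n] by (simp add: algebra_simps)
  then have "((\<lambda>c. real (c m) * w c) has_sum x m * (occ_sum m n + Z UNIV n))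
      {c \<in> confs UNIV (Suc n). c m \<noteq> 0}"
    by (intro occupied_has_sum) simp_all
  then have "((\<lambda>c. real (c m) * w c) has_sum x m * (occ_sum m n + Z UNIV n)) (confs UNIV (Suc n))"
    by (rule has_sum_cong_neutral[THEN iffD1, rotated -1]) auto
  then show ?thesis using occ_has_sum has_sum_unique by blast
qed

lemma occ_sum_nonneg: "0 \<le> occ_sum m n"
  using has_sum_nonneg[OF occ_has_sum] w_pos by (simp add: less_imp_le)

lemma canonical_occupation_incseq: "incseq (\<lambda>n. occ_sum m n / Z UNIV n)"
proof -
  let ?D = "\<lambda>n. occ_sum m n / Z UNIV n" and ?q = "\<lambda>n. Z UNIV n / Z UNIV (Suc n)"
  \<comment> \<open>Dividing the recursion by \<open>Z UNIV (Suc n)\<close> separates two factors: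
    \<open>?q n\<close>, increasing by log-concavity, and \<open>?D n + 1\<close>, handled by
    induction.\<close>
  have D: "?D (Suc n) = x m * (?q n * (?D n + 1))" for n
    using canonical_part_pos[of n] canonical_part_pos[of "Suc n"]
    by (simp add: occ_sum_Suc field_simps)
  have q: "?q n \<le> ?q (Suc n)" for n
    using log_concave_canonical_part canonical_part_pos[of "Suc n"] canonical_part_pos[of "Suc (Suc n)"]
    by (simp add: log_concave_seq_def divide_simps)
  have D0: "0 \<le> ?D n" for n
    by (intro divide_nonneg_nonneg occ_sum_nonneg canonical_part_nonneg)
  have "?D n \<le> ?D (Suc n)" for n
  proof (induction n)
    case 0
    then show ?case using D0[of 1] by simp
  next
    case (Suc n)
    have "?q n * (?D n + 1) \<le> ?q (Suc n) * (?D (Suc n) + 1)"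
      using Suc D0[of n] canonical_part_nonneg by (intro mult_mono q) simp_all
    then show ?case
      unfolding D[of "Suc n"] D[of n] using x_pos[of m] by (intro mult_left_mono) simp_all
  qed
  then show ?thesis by (rule incseq_SucI)
qed

end

text \<open>Up to the factor \<open>z\<close> this is the termwise derivative.
  \<open>powser_inside\<close> extends the hypothesis to negative arguments.\<close>

lemma summable_powser_times_index:
  fixes c :: "nat \<Rightarrow> real"
  assumes sm: "\<And>z. 0 \<le> z \<Longrightarrow> z < R \<Longrightarrow> summable (\<lambda>n. c n * z ^ n)"
    and z: "0 \<le> z" "z < R"
  shows "summable (\<lambda>n. real n * (c n * z ^ n))"
proof -
  have "summable (\<lambda>n. diffs c n * z ^ n)"
  proof (rule termdiff_converges)
    show "norm z < R" using z by simp
    fix y :: real assume y: "norm y < R"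
    show "summable (\<lambda>n. c n * y ^ n)"
      by (rule powser_inside[OF sm[of "(norm y + R) / 2"]]) (use y in auto)
  qed
  then have "summable (\<lambda>n. z * (diffs c n * z ^ n))" by (rule summable_mult)
  then have "summable (\<lambda>n. real (Suc n) * (c (Suc n) * z ^ Suc n))"
    by (simp add: diffs_def algebra_simps)
  then show ?thesis by (subst (asm) summable_Suc_iff)
qed

section \<open>Grand-canonical sums\<close>

context boson_modes
begin

text \<open>A further mode divides the generating function by \<open>1 - x m * z\<close>.\<close>

lemma grand_summable_insert_mode:
  assumes sm: "summable (\<lambda>n. Z A n * z ^ n)" and m: "m \<notin> A" and z: "0 \<le> z" "x m * z < 1"
  shows "summable (\<lambda>n. Z (insert m A) n * z ^ n)"
proof (rule summableI_nonneg_bounded)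
  let ?S = "\<Sum>n. Z A n * z ^ n" and ?b = "\<lambda>n. Z (insert m A) n * z ^ n"
  \<comment> \<open>The fixed point of \<open>K = ?S + x m * z * K\<close>, so the bound reproduces
    itself when the recursion is applied to a partial sum.\<close>
  let ?K = "?S / (1 - x m * z)"
  show "0 \<le> ?b n" for n using z by (simp add: canonical_part_nonneg)
  have K: "?S + x m * z * ?K = ?K" using z by (simp add: field_simps)
  have S: "(\<Sum>n<N. Z A n * z ^ n) \<le> ?S" for N
    by (rule sum_le_suminf[OF sm]) (use z in \<open>simp_all add: canonical_part_nonneg\<close>)
  show "(\<Sum>n<N. ?b n) \<le> ?K" for N
  proof (induction N)
    case 0
    show ?case using S[of 0] z by simp
  next
    case (Suc N)
    have "(\<Sum>n<Suc N. ?b n) = (\<Sum>n<Suc N. Z A n * z ^ n) + x m * z * (\<Sum>n<N. ?b n)"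
      unfolding sum.lessThan_Suc_shift
      by (simp add: canonical_part_insert_mode[OF m] sum.distrib sum_distrib_left algebra_simps)
    also have "\<dots> \<le> ?S + x m * z * ?K"
      using x_pos[of m] z by (intro add_mono S mult_left_mono Suc) (auto simp: less_imp_le)
    finally show ?case unfolding K .
  qed
qed

text \<open>Outside a suitable finite \<open>F\<close> the Boltzmann factors have so small a sum
  that a geometric series dominates; the modes of \<open>F\<close> are then put back one by
  one.\<close>

lemma grand_summable:
  assumes z: "0 \<le> z" "\<And>m. x m * z < 1"
  shows "summable (\<lambda>n. Z UNIV n * z ^ n)"
proof -
  have "(sum x \<longlongrightarrow> infsum x UNIV) (finite_subsets_at_top UNIV)"
    using has_sum_infsum[OF x_summable] by (simp add: has_sum_def)
  \<comment> \<open>Using \<open>1 / (z + 1)\<close> instead of \<open>1 / z\<close> covers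
    \<open>z = 0\<close> and still forces \<open>infsum x (- F) * z < 1\<close>.\<close>
  moreover have "infsum x UNIV - 1 / (z + 1) < infsum x UNIV" using z by simp
  ultimately have "\<forall>\<^sub>F F in finite_subsets_at_top UNIV. infsum x UNIV - 1 / (z + 1) < sum x F"
    by (rule order_tendstoD)
  then obtain F where F: "finite F" "infsum x UNIV - 1 / (z + 1) < sum x F"
    by (auto simp: eventually_finite_subsets_at_top)
  have "infsum x (F \<union> - F) = infsum x F + infsum x (- F)"
    by (rule infsum_Un_disjoint[OF x_summable_on x_summable_on]) auto
  then have r: "infsum x (- F) < 1 / (z + 1)" using F by simp
  have r0: "0 \<le> infsum x (- F)" by (intro infsum_nonneg less_imp_le x_pos)
  have rz: "infsum x (- F) * z < 1"
  proof -
    have "infsum x (- F) * (z + 1) < 1" using r z by (simp add: divide_simps)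
    then show ?thesis using r0 by (simp add: algebra_simps)
  qed
  have base: "summable (\<lambda>n. Z (- F) n * z ^ n)"
  proof (rule summable_comparison_test')
    show "summable (\<lambda>n. (infsum x (- F) * z) ^ n)" using rz r0 z by (intro summable_geometric) simp
    show "norm (Z (- F) n * z ^ n) \<le> (infsum x (- F) * z) ^ n" for n
      using canonical_part_le_power[of "- F" n] z
      by (simp add: power_mult_distrib canonical_part_nonneg mult_right_mono)
  qed
  have "summable (\<lambda>n. Z (- F \<union> G) n * z ^ n)" if "finite G" "G \<subseteq> F" for G
    using that
  proof (induction G rule: finite_induct)
    case (insert m G)
    then show ?case
      using grand_summable_insert_mode[of "- F \<union> G" z m] z by simp
  qed (simp add: base)
  from this[of F] show ?thesis using F by (simp add: Un_commute)
qed

text \<open>Sorting configurations by particle number turns a Fock-space sum into a power series in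
  the fugacity; nonnegativity justifies the rearrangement.\<close>

lemma grand_has_sum:
  assumes F: "\<And>c. 0 \<le> F c" and s: "\<And>n. ((\<lambda>c. F c * w c) has_sum s n) (confs UNIV n)"
    and z: "0 \<le> z" and sm: "summable (\<lambda>n. s n * z ^ n)"
  shows "((\<lambda>c. F c * (w c * z ^ total_num c)) has_sum (\<Sum>n. s n * z ^ n)) fock_confs"
proof -
  let ?f = "\<lambda>(n, c). F c * (w c * z ^ total_num c)"
  let ?P = "Sigma UNIV (confs UNIV)"
  have s0: "0 \<le> s n" for n
    using has_sum_nonneg[OF s] F w_pos by (simp add: less_imp_le)
  have inner: "((\<lambda>c. ?f (n, c)) has_sum s n * z ^ n) (confs UNIV n)" for n
    using has_sum_cmult_left[OF s, of "z ^ n" n]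
    by (rule has_sum_cong[THEN iffD1, rotated]) (simp add: confs_def)
  have outer: "((\<lambda>n. s n * z ^ n) has_sum (\<Sum>n. s n * z ^ n)) UNIV"
    using sm s0 z by (intro norm_summable_imp_has_sum summable_sums) simp_all
  have "?f summable_on ?P"
    by (rule summable_on_SigmaI[OF inner has_sum_imp_summable[OF outer]])
      (simp add: F z w_pos less_imp_le)
  then have "(?f has_sum (\<Sum>n. s n * z ^ n)) ?P" by (rule has_sum_SigmaI[OF inner outer])
  \<comment> \<open>The configuration determines its particle number, so forgetting the latter is
    bijective.\<close>
  moreover have "bij_betw snd ?P fock_confs"
    by (auto simp: bij_betw_def inj_on_def image_def confs_def fock_confs_def)
  from has_sum_reindex_bij_betw[OF this, of "\<lambda>c. F c * (w c * z ^ total_num c)"]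
  have "((\<lambda>p. F (snd p) * (w (snd p) * z ^ total_num (snd p))) has_sum (\<Sum>n. s n * z ^ n)) ?P
      \<longleftrightarrow> ((\<lambda>c. F c * (w c * z ^ total_num c)) has_sum (\<Sum>n. s n * z ^ n)) fock_confs" .
  ultimately show ?thesis by (simp add: case_prod_unfold)
qed

lemma total_num_has_sum: "((\<lambda>c. real (total_num c) * w c) has_sum real n * Z UNIV n) (confs UNIV n)"
  using has_sum_cmult_right[OF w_has_sum, of "real n"]
  by (rule has_sum_cong[THEN iffD1, rotated]) (simp add: confs_def)

lemma occ_sum_le: "occ_sum m n \<le> real n * Z UNIV n"
  by (rule has_sum_mono[OF occ_has_sum total_num_has_sum])
    (auto simp: confs_def less_imp_le w_pos intro!: mult_right_mono occ_le_total_num)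

end

section \<open>Fugacities below the ground-state threshold\<close>

locale boson_modes_ground = boson_modes +
  fixes g :: mode
  assumes ground: "\<And>m. x m \<le> x g"
begin

lemma below_ground:
  assumes "z < 1 / x g" "0 \<le> z"
  shows "x m * z < 1"
proof -
  have "x m * z \<le> x g * z" using ground assms by (intro mult_right_mono)
  also have "\<dots> < 1" using assms x_pos[of g] by (simp add: field_simps)
  finally show ?thesis .
qed

lemma part_summable: "0 \<le> z \<Longrightarrow> z < 1 / x g \<Longrightarrow> summable (\<lambda>n. Z UNIV n * z ^ n)"
  by (intro grand_summable below_ground)

lemma number_summable: "0 \<le> z \<Longrightarrow> z < 1 / x g \<Longrightarrow> summable (\<lambda>n. real n * (Z UNIV n * z ^ n))"
  by (rule summable_powser_times_index[OF part_summable])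

lemma tilted_summable:
  "0 \<le> z \<Longrightarrow> z < 1 / x g \<Longrightarrow> summable (\<lambda>i. (real i - real n) * (Z UNIV i * z ^ i))"
  using summable_diff[OF number_summable summable_mult[OF part_summable, of _ "real n"], of z z]
  by (simp add: left_diff_distrib)

lemma tilted_sum:
  "0 \<le> z \<Longrightarrow> z < 1 / x g \<Longrightarrow> (\<Sum>i. (real i - real n) * (Z UNIV i * z ^ i))
    = (\<Sum>i. real i * (Z UNIV i * z ^ i)) - real n * (\<Sum>i. Z UNIV i * z ^ i)"
  using suminf_diff[OF number_summable summable_mult[OF part_summable, of _ "real n"], of z z]
    suminf_mult[OF part_summable, of z "real n"]
  by (simp add: left_diff_distrib)

lemma occ_summable:
  assumes "0 \<le> z" "z < 1 / x g"
  shows "summable (\<lambda>n. occ_sum m n * z ^ n)"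
proof (rule summable_comparison_test')
  show "summable (\<lambda>n. real n * (Z UNIV n * z ^ n))" using assms by (rule number_summable)
  show "norm (occ_sum m n * z ^ n) \<le> real n * (Z UNIV n * z ^ n)" for n
    using mult_right_mono[OF occ_sum_le, of "z ^ n" m n] assms
    by (simp add: occ_sum_nonneg mult.assoc)
qed

lemma part_grand_pos:
  assumes "0 < z" "z < 1 / x g"
  shows "0 < (\<Sum>n. Z UNIV n * z ^ n)"
  using assms by (intro suminf_pos part_summable) (simp_all add: canonical_part_pos)

text \<open>The weight of having all particles in \<open>g\<close> supplies the lower bound 1 at the
  threshold \<open>1 / x g\<close>, so every positive integer mean is reached below it.\<close>

lemma fugacity_exists:
  assumes "0 < n"
  obtains z where "0 < z" "z < 1 / x g" "(\<Sum>i. (real i - real n) * (Z UNIV i * z ^ i)) = 0"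
proof (rule powser_tilted_mean_exists[of "1 / x g" n "Z UNIV"])
  show "1 \<le> Z UNIV i * (1 / x g) ^ i" for i
    using canonical_part_ge_power[of g i] x_pos[of g] by (simp add: power_divide)
qed (use x_pos assms tilted_summable that in auto)

lemma fugacity_unique:
  assumes "0 < n" "0 < y" "y < 1 / x g" "0 < z" "z < 1 / x g"
    and "(\<Sum>i. (real i - real n) * (Z UNIV i * y ^ i)) = 0"
    and "(\<Sum>i. (real i - real n) * (Z UNIV i * z ^ i)) = 0"
  shows "y = z"
  by (rule powser_tilted_mean_unique[OF canonical_part_pos])
    (use assms tilted_summable in \<open>auto simp: less_imp_le\<close>)

text \<open>Tilting by \<open>z ^ i\<close> preserves log-concavity, as both products acquire the
  same power of \<open>z\<close>; the increasing sequence averaged is the canonical occupation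
  number.\<close>

lemma canonical_occupation_le_grand:
  assumes z: "0 < z" "z < 1 / x g" and mean: "(\<Sum>i. (real i - real n) * (Z UNIV i * z ^ i)) = 0"
  shows "occ_sum m n / Z UNIV n \<le> 4 * ((\<Sum>i. occ_sum m i * z ^ i) / (\<Sum>i. Z UNIV i * z ^ i))"
proof -
  have C: "occ_sum m i / Z UNIV i * (Z UNIV i * z ^ i) = occ_sum m i * z ^ i" for i
    using canonical_part_pos[of i] by simp
  have lc: "log_concave_seq (\<lambda>i. Z UNIV i * z ^ i)"
    unfolding log_concave_seq_def
  proof (intro conjI allI impI)
    show "0 \<le> Z UNIV i * z ^ i" for i using z by (simp add: canonical_part_nonneg)
    fix i j :: nat assume "i \<le> j"
    then have "Z UNIV i * Z UNIV (Suc j) \<le> Z UNIV (Suc i) * Z UNIV j"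
      using log_concave_canonical_part by (simp add: log_concave_seq_def)
    from mult_right_mono[OF this, of "z ^ Suc (i + j)"] z
    show "Z UNIV i * z ^ i * (Z UNIV (Suc j) * z ^ Suc j)
        \<le> Z UNIV (Suc i) * z ^ Suc i * (Z UNIV j * z ^ j)"
      by (simp add: power_add algebra_simps)
  qed
  have "occ_sum m n / Z UNIV n * (\<Sum>i. Z UNIV i * z ^ i)
      \<le> 4 * (\<Sum>i. occ_sum m i / Z UNIV i * (Z UNIV i * z ^ i))"
  proof (rule log_concave_seq_value_at_mean_le[OF lc _ _ _ mean])
    show "summable (\<lambda>i. occ_sum m i / Z UNIV i * (Z UNIV i * z ^ i))"
      unfolding C using z by (intro occ_summable) simp_all
  qed (use z in \<open>simp_all add: canonical_part_pos part_summable number_summable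
      occ_sum_nonneg canonical_part_nonneg canonical_occupation_incseq\<close>)
  then show ?thesis unfolding C using part_grand_pos[OF z] by (simp add: field_simps)
qed

end

section \<open>The perfect Bose gas in a box\<close>

definition boltzmann :: "real \<Rightarrow> real \<Rightarrow> real \<Rightarrow> real \<Rightarrow> real \<Rightarrow> mode \<Rightarrow> real" where
  "boltzmann a1 a2 a3 \<beta> V m = exp (- \<beta> * mode_energy a1 a2 a3 V m)"

text \<open>From \<open>k \<le> (k + 1) ^ 2\<close>. Linear growth is enough for finiteness of
  energy level sets and for geometric domination of the Boltzmann factors.\<close>

lemma mode_energy_ge_linear:
  assumes "0 < V"
  obtains e where "0 < e" "\<And>i j l. e * (real i + real j + real l) \<le> mode_energy a1 a2 a3 V (i, j, l)"
proof -
  define e1 e2 e3 where "e1 = pi\<^sup>2 / 2 / (V powr a1)\<^sup>2" and "e2 = pi\<^sup>2 / 2 / (V powr a2)\<^sup>2"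
    and "e3 = pi\<^sup>2 / 2 / (V powr a3)\<^sup>2"
  define e where "e = min e1 (min e2 e3)"
  have pos: "0 < e1" "0 < e2" "0 < e3" using assms by (simp_all add: e1_def e2_def e3_def)
  show ?thesis
  proof (rule that)
    show "0 < e" using pos by (simp add: e_def)
    fix i j l :: nat
    have sq: "e * real k \<le> d * (real (Suc k))\<^sup>2" if "e \<le> d" "0 < d" for k d
    proof -
      have "real k \<le> (real (Suc k))\<^sup>2" by (simp add: power2_eq_square algebra_simps)
      then show ?thesis using that by (intro mult_mono) auto
    qed
    have "e * (real i + real j + real l) = e * real i + e * real j + e * real l"
      by (simp add: algebra_simps)
    also have "\<dots> \<le> e1 * (real (Suc i))\<^sup>2 + e2 * (real (Suc j))\<^sup>2 + e3 * (real (Suc l))\<^sup>2"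
      by (intro add_mono sq pos) (simp_all add: e_def)
    also have "\<dots> = mode_energy a1 a2 a3 V (i, j, l)"
      unfolding mode_energy_def e1_def e2_def e3_def prod.case
      by (simp only: power_divide distrib_left times_divide_eq_right times_divide_eq_left)
    finally show "e * (real i + real j + real l) \<le> mode_energy a1 a2 a3 V (i, j, l)" .
  qed
qed

lemma mode_energy_ground:
  "mode_energy a1 a2 a3 V (0, 0, 0) \<le> mode_energy a1 a2 a3 V m"
proof -
  obtain i j l where m: "m = (i, j, l)" by (cases m)
  show ?thesis
    unfolding m mode_energy_def prod.case
    by (intro mult_left_mono add_mono power_mono divide_right_mono) simp_all
qed

lemma eigenvalue_1:
  assumes "0 < V"
  shows "eigenvalue a1 a2 a3 V 1 = mode_energy a1 a2 a3 V (0, 0, 0)"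
proof -
  let ?E0 = "mode_energy a1 a2 a3 V (0, 0, 0)"
  obtain e where e: "0 < e"
    "\<And>i j l. e * (real i + real j + real l) \<le> mode_energy a1 a2 a3 V (i, j, l)"
    using mode_energy_ge_linear[OF assms] by metis
  \<comment> \<open>\<open>card\<close> is 0 on infinite sets, so the counting condition in
    \<open>eigenvalue\<close> means what it should only once these sets are finite.\<close>
  have fin: "finite {m. mode_energy a1 a2 a3 V m \<le> E}" for E
  proof (rule finite_subset)
    let ?N = "{..nat \<lceil>E / e\<rceil>}"
    show "{m. mode_energy a1 a2 a3 V m \<le> E} \<subseteq> ?N \<times> ?N \<times> ?N"
    proof
      fix m assume m: "m \<in> {m. mode_energy a1 a2 a3 V m \<le> E}"
      obtain i j l where ijl: "m = (i, j, l)" by (cases m)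
      have "e * (real i + real j + real l) \<le> E" using e(2)[of i j l] m ijl by simp
      then have "real i + real j + real l \<le> E / e" using e(1) by (simp add: field_simps)
      then have "real i \<le> E / e" "real j \<le> E / e" "real l \<le> E / e" by simp_all
      then show "m \<in> ?N \<times> ?N \<times> ?N" unfolding ijl by simp linarith
    qed
  qed simp
  have "1 \<le> card {m. mode_energy a1 a2 a3 V m \<le> E} \<longleftrightarrow> ?E0 \<le> E" for E
    using fin[of E] order_trans[OF mode_energy_ground[of a1 a2 a3 V], of _ E]
    by (auto simp: Suc_le_eq card_gt_0_iff simp del: split_paired_Ex)
  then have "{E. 1 \<le> card {m. mode_energy a1 a2 a3 V m \<le> E}} = {?E0..}" by auto
  then show ?thesis by (simp add: eigenvalue_def)
qed

text \<open>The linear energy bound gives domination by a product of three geometric series of ratio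
  \<open>exp (- \<beta> * e)\<close>.\<close>

lemma boltzmann_summable:
  assumes "0 < V" "0 < \<beta>"
  shows "boltzmann a1 a2 a3 \<beta> V summable_on UNIV"
proof -
  obtain e where e: "0 < e"
    "\<And>i j l. e * (real i + real j + real l) \<le> mode_energy a1 a2 a3 V (i, j, l)"
    using mode_energy_ge_linear[OF assms(1)] by metis
  define r where "r = exp (- \<beta> * e)"
  have r: "0 < r" "r < 1" using assms e by (simp_all add: r_def)
  have geo: "((\<lambda>i. r ^ i) has_sum (1 / (1 - r))) UNIV"
    using r by (intro norm_summable_imp_has_sum geometric_sums) (simp_all add: power_abs summable_geometric)
  have 2: "((\<lambda>(j, l). r ^ j * r ^ l) has_sum (1 / (1 - r)) * (1 / (1 - r))) (UNIV \<times> UNIV)"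
  proof -
    have inner: "((\<lambda>l. case (j, l) of (j, l) \<Rightarrow> r ^ j * r ^ l) has_sum r ^ j * (1 / (1 - r))) UNIV" for j
      using has_sum_cmult_right[OF geo, of "r ^ j"] by simp
    have outer: "((\<lambda>j. r ^ j * (1 / (1 - r))) has_sum (1 / (1 - r)) * (1 / (1 - r))) UNIV"
      by (rule has_sum_cmult_left[OF geo])
    show ?thesis
      by (rule has_sum_SigmaI[OF inner outer summable_on_SigmaI[OF inner has_sum_imp_summable[OF outer]]])
        (use r in simp)
  qed
  have 3: "(\<lambda>(i, q). r ^ i * (case q of (j, l) \<Rightarrow> r ^ j * r ^ l)) summable_on (UNIV \<times> UNIV \<times> UNIV)"
  proof (rule summable_on_SigmaI)
    show "((\<lambda>q. case (i, q) of (i, q) \<Rightarrow> r ^ i * (case q of (j, l) \<Rightarrow> r ^ j * r ^ l))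
        has_sum r ^ i * ((1 / (1 - r)) * (1 / (1 - r)))) (UNIV \<times> UNIV)" for i
      using has_sum_cmult_right[OF 2, of "r ^ i"] by simp
    show "(\<lambda>i. r ^ i * ((1 / (1 - r)) * (1 / (1 - r)))) summable_on UNIV"
      by (intro summable_on_cmult_left has_sum_imp_summable[OF geo])
  qed (use r in auto)
  show ?thesis
  proof (rule summable_on_comparison_test)
    show "(\<lambda>(i, q). r ^ i * (case q of (j, l) \<Rightarrow> r ^ j * r ^ l)) summable_on UNIV" using 3 by simp
    fix m :: mode
    obtain i j l where m: "m = (i, j, l)" by (cases m)
    have "boltzmann a1 a2 a3 \<beta> V m \<le> exp (- \<beta> * (e * (real i + real j + real l)))"
      unfolding boltzmann_def m using e(2)[of i j l] assms by simp
    also have "\<dots> = r ^ i * (r ^ j * r ^ l)"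
      by (simp add: r_def exp_of_nat_mult[symmetric] exp_add[symmetric] algebra_simps)
    finally show "boltzmann a1 a2 a3 \<beta> V m \<le> (case m of (i, q) \<Rightarrow> r ^ i * (case q of (j, l) \<Rightarrow> r ^ j * r ^ l))"
      by (simp add: m)
  qed (simp add: boltzmann_def)
qed

lemma boson_modes_ground_boltzmann:
  assumes "0 < V" "0 < \<beta>"
  shows "boson_modes_ground (boltzmann a1 a2 a3 \<beta> V) (0, 0, 0)"
proof unfold_locales
  show "boltzmann a1 a2 a3 \<beta> V summable_on UNIV" by (rule boltzmann_summable[OF assms])
  show "boltzmann a1 a2 a3 \<beta> V m \<le> boltzmann a1 a2 a3 \<beta> V (0, 0, 0)" for m
    using mode_energy_ground[of a1 a2 a3 V m] assms by (simp add: boltzmann_def)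
qed (simp add: boltzmann_def)

lemma exp_total_energy: "exp (- \<beta> * total_energy a1 a2 a3 V c) = occ_weight (boltzmann a1 a2 a3 \<beta> V) c"
proof (cases "finite (supp_occ c)")
  case True
  have "- \<beta> * total_energy a1 a2 a3 V c = (\<Sum>m\<in>supp_occ c. real (c m) * (- \<beta> * mode_energy a1 a2 a3 V m))"
    unfolding total_energy_def sum_distrib_left by (intro sum.cong) simp_all
  then show ?thesis
    using True by (simp only: exp_sum occ_weight_def boltzmann_def exp_of_nat_mult)
next
  \<comment> \<open>On an infinite support the sum defaults to 0 and the product to 1, so both sides
    are 1.\<close>
  case False
  then show ?thesis by (simp add: occ_weight_def total_energy_def)
qed

lemma gc_weight_eq:
  "gc_weight a1 a2 a3 \<beta> V \<mu> c = occ_weight (boltzmann a1 a2 a3 \<beta> V) c * exp (\<beta> * \<mu>) ^ total_num c"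
proof -
  have "gc_weight a1 a2 a3 \<beta> V \<mu> c
      = exp (- \<beta> * total_energy a1 a2 a3 V c) * exp (real (total_num c) * (\<beta> * \<mu>))"
    unfolding gc_weight_def exp_add[symmetric] by (simp add: algebra_simps)
  then show ?thesis by (simp only: exp_total_energy exp_of_nat_mult)
qed

text \<open>Integrality of \<open>\<rho> * V\<close> makes the grand-canonical mean particle number
  equal to the canonical one, so the fugacity form of the comparison applies.\<close>

lemma can_state_le_gc_state:
  assumes \<beta>: "0 < \<beta>" and V: "0 < V" and \<rho>: "0 < \<rho>" and n: "\<rho> * V = real n"
  shows "can_state a1 a2 a3 \<beta> V n (\<lambda>c. real (c m))
    \<le> 4 * gc_state a1 a2 a3 \<beta> V (chem_pot a1 a2 a3 \<beta> V \<rho>) (\<lambda>c. real (c m))"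
proof -
  let ?x = "boltzmann a1 a2 a3 \<beta> V"
  interpret boson_modes_ground ?x "(0, 0, 0)"
    using V \<beta> by (rule boson_modes_ground_boltzmann)
  have n0: "0 < n" using V \<rho> n by (metis mult_pos_pos of_nat_0_less_iff)
  have dom: "exp (\<beta> * \<mu>) < 1 / ?x (0, 0, 0) \<longleftrightarrow> \<mu> < eigenvalue a1 a2 a3 V 1" for \<mu>
    unfolding eigenvalue_1[OF V] using \<beta> by (simp add: boltzmann_def exp_minus field_simps)
  have grand: "infsum (\<lambda>c. F c * gc_weight a1 a2 a3 \<beta> V \<mu> c) fock_confs = (\<Sum>n. s n * exp (\<beta> * \<mu>) ^ n)"
    if "\<And>c. 0 \<le> F c" "\<And>n. ((\<lambda>c. F c * w c) has_sum s n) (confs UNIV n)"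
      "summable (\<lambda>n. s n * exp (\<beta> * \<mu>) ^ n)" for F s \<mu>
    unfolding gc_weight_eq using that by (intro infsumI grand_has_sum) simp_all
  have part: "infsum (gc_weight a1 a2 a3 \<beta> V \<mu>) fock_confs = (\<Sum>n. Z UNIV n * exp (\<beta> * \<mu>) ^ n)"
    if "\<mu> < eigenvalue a1 a2 a3 V 1" for \<mu>
    using grand[of "\<lambda>_. 1" "Z UNIV" \<mu>] w_has_sum part_summable that by (simp add: dom)
  have number: "gc_state a1 a2 a3 \<beta> V \<mu> (\<lambda>c. real (total_num c)) / V = \<rho>
      \<longleftrightarrow> (\<Sum>i. (real i - real n) * (Z UNIV i * exp (\<beta> * \<mu>) ^ i)) = 0"
    if \<mu>: "\<mu> < eigenvalue a1 a2 a3 V 1" for \<mu>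
  proof -
    have z: "0 < exp (\<beta> * \<mu>)" "exp (\<beta> * \<mu>) < 1 / ?x (0, 0, 0)" using \<mu> by (simp_all add: dom)
    have "infsum (\<lambda>c. real (total_num c) * gc_weight a1 a2 a3 \<beta> V \<mu> c) fock_confs
        = (\<Sum>i. real i * (Z UNIV i * exp (\<beta> * \<mu>) ^ i))"
      using grand[of "\<lambda>c. real (total_num c)" "\<lambda>i. real i * Z UNIV i" \<mu>] total_num_has_sum
        number_summable[of "exp (\<beta> * \<mu>)"] z by (simp add: mult.assoc)
    then have "gc_state a1 a2 a3 \<beta> V \<mu> (\<lambda>c. real (total_num c))
        = (\<Sum>i. real i * (Z UNIV i * exp (\<beta> * \<mu>) ^ i)) / (\<Sum>i. Z UNIV i * exp (\<beta> * \<mu>) ^ i)"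
      using part[OF \<mu>] by (simp add: gc_state_def)
    moreover have "(a / b) / V = \<rho> \<longleftrightarrow> a - real n * b = 0" if "0 < b" for a b
      using that V by (simp add: n[symmetric] field_simps)
    ultimately show ?thesis
      using part_grand_pos[OF z] tilted_sum[of "exp (\<beta> * \<mu>)" n] z by simp
  qed
  define \<mu> where "\<mu> = chem_pot a1 a2 a3 \<beta> V \<rho>"
  \<comment> \<open>\<open>chem_pot\<close> is a definite description, so its defining equation is
    available only after unique existence; this transfers from fugacities through
    \<open>z = exp (\<beta> * \<mu>)\<close>.\<close>
  have "\<exists>!\<mu>. \<mu> < eigenvalue a1 a2 a3 V 1 \<and>
      gc_state a1 a2 a3 \<beta> V \<mu> (\<lambda>c. real (total_num c)) / V = \<rho>"
  proof -
    obtain z where z: "0 < z" "z < 1 / ?x (0, 0, 0)"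
      "(\<Sum>i. (real i - real n) * (Z UNIV i * z ^ i)) = 0"
      using fugacity_exists[OF n0] by metis
    have e: "exp (\<beta> * (ln z / \<beta>)) = z" using z \<beta> by simp
    show ?thesis
    proof (rule ex1I[of _ "ln z / \<beta>"])
      have "ln z / \<beta> < eigenvalue a1 a2 a3 V 1" using dom[of "ln z / \<beta>"] z unfolding e by simp
      then show "ln z / \<beta> < eigenvalue a1 a2 a3 V 1 \<and>
          gc_state a1 a2 a3 \<beta> V (ln z / \<beta>) (\<lambda>c. real (total_num c)) / V = \<rho>"
        using number[of "ln z / \<beta>"] z unfolding e by simp
      fix \<nu> assume \<nu>: "\<nu> < eigenvalue a1 a2 a3 V 1 \<and>
          gc_state a1 a2 a3 \<beta> V \<nu> (\<lambda>c. real (total_num c)) / V = \<rho>"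
      then have "exp (\<beta> * \<nu>) = z"
        using number[of \<nu>] dom[of \<nu>] by (intro fugacity_unique[OF n0 _ _ z(1,2) _ z(3)]) auto
      then have "\<beta> * \<nu> = ln z" using z by auto
      then show "\<nu> = ln z / \<beta>" using \<beta> by (simp add: field_simps)
    qed
  qed
  from theI'[OF this] have \<mu>: "\<mu> < eigenvalue a1 a2 a3 V 1"
    "gc_state a1 a2 a3 \<beta> V \<mu> (\<lambda>c. real (total_num c)) / V = \<rho>"
    by (simp_all add: \<mu>_def chem_pot_def)
  let ?z = "exp (\<beta> * \<mu>)"
  have z: "0 < ?z" "?z < 1 / ?x (0, 0, 0)" using \<mu> by (simp_all add: dom)
  have confs: "{c \<in> fock_confs. total_num c = n} = confs UNIV n"
    by (auto simp: fock_confs_def confs_def)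
  have "can_state a1 a2 a3 \<beta> V n (\<lambda>c. real (c m)) = occ_sum m n / Z UNIV n"
    by (simp only: can_state_def confs exp_total_energy occ_sum_def canonical_part_def)
  also have "\<dots> \<le> 4 * ((\<Sum>i. occ_sum m i * ?z ^ i) / (\<Sum>i. Z UNIV i * ?z ^ i))"
    using number[OF \<mu>(1)] \<mu>(2) by (intro canonical_occupation_le_grand z) simp
  also have "(\<Sum>i. occ_sum m i * ?z ^ i) / (\<Sum>i. Z UNIV i * ?z ^ i)
      = gc_state a1 a2 a3 \<beta> V \<mu> (\<lambda>c. real (c m))"
    using grand[of "\<lambda>c. real (c m)" "occ_sum m" \<mu>] occ_has_sum occ_summable[of ?z m] z part[OF \<mu>(1)]
    by (simp add: gc_state_def)
  finally show ?thesis by (simp add: \<mu>_def)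
qed

section \<open>Passage to infinite volume\<close>

theorem theorem3p3:
  fixes a1 a2 a3 \<beta> \<rho> :: real and k :: nat
    and K :: "real \<Rightarrow> real measure" and g :: "real \<Rightarrow> real"
  assumes "a1 \<ge> a2" and "a2 \<ge> a3" and "a3 > 0" and "a1 + a2 + a3 = 1" and "\<beta> > 0"
    and "k \<ge> 1" and "\<rho> > 0"
    and gc_lim: "\<forall>\<^sub>F \<rho>' in nhds \<rho>.
      ((\<lambda>V. gc_state a1 a2 a3 \<beta> V (chem_pot a1 a2 a3 \<beta> V \<rho>')
               (\<lambda>c. real (c (eigenstate a1 a2 a3 V k))) / V) \<longlongrightarrow> g \<rho>') at_top"
    and "isCont g \<rho>"
    and kac_lim: "\<forall>\<^sub>F \<rho>' in nhds \<rho>. sets (K \<rho>') = sets borel \<and> finite_measure (K \<rho>')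
                    \<and> kac_weak_limit a1 a2 a3 \<beta> \<rho>' (K \<rho>')"
    and "isCont (\<lambda>\<rho>'. measure (K \<rho>') {\<rho>..}) \<rho>"
    and "measure (K \<rho>) {\<rho>..} \<noteq> 0"
    and "g \<rho> = 0"
  shows "(\<lambda>n. can_state a1 a2 a3 \<beta> (real n / \<rho>) n
                 (\<lambda>c. real (c (eigenstate a1 a2 a3 (real n / \<rho>) k))) / (real n / \<rho>))
         \<longlonglongrightarrow> 0"
proof -
  let ?G = "\<lambda>V. gc_state a1 a2 a3 \<beta> V (chem_pot a1 a2 a3 \<beta> V \<rho>)
               (\<lambda>c. real (c (eigenstate a1 a2 a3 V k))) / V"
  let ?C = "\<lambda>n. can_state a1 a2 a3 \<beta> (real n / \<rho>) n
                 (\<lambda>c. real (c (eigenstate a1 a2 a3 (real n / \<rho>) k))) / (real n / \<rho>)"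
  \<comment> \<open>What holds eventually in \<open>nhds \<rho>\<close> holds at
    \<open>\<rho>\<close> itself.\<close>
  have "(?G \<longlongrightarrow> 0) at_top"
    using eventually_nhds_x_imp_x[OF gc_lim] \<open>g \<rho> = 0\<close> by simp
  moreover have "filterlim (\<lambda>n. real n / \<rho>) at_top sequentially"
    using filterlim_tendsto_pos_mult_at_top[OF tendsto_const _ filterlim_real_sequentially, of "1 / \<rho>"]
      \<open>\<rho> > 0\<close> by simp
  ultimately have "(\<lambda>n. ?G (real n / \<rho>)) \<longlonglongrightarrow> 0" by (rule filterlim_compose)
  then have G: "(\<lambda>n. 4 * ?G (real n / \<rho>)) \<longlonglongrightarrow> 0" using tendsto_mult_right_zero by blast
  show ?thesis
  proof (rule tendsto_sandwich[OF _ _ tendsto_const G])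
    show "\<forall>\<^sub>F n in sequentially. 0 \<le> ?C n"
      unfolding can_state_def using \<open>\<rho> > 0\<close>
      by (intro always_eventually allI divide_nonneg_nonneg infsum_nonneg) simp_all
    \<comment> \<open>The volume is positive only for \<open>n > 0\<close>. That the
      \<open>k\<close>-th eigenstate varies with the volume is harmless, since the comparison holds
      for every mode.\<close>
    show "\<forall>\<^sub>F n in sequentially. ?C n \<le> 4 * ?G (real n / \<rho>)"
      using eventually_gt_at_top[of 0]
    proof eventually_elim
      case (elim n)
      then have V: "0 < real n / \<rho>" using \<open>\<rho> > 0\<close> by simp
      from can_state_le_gc_state[OF \<open>\<beta> > 0\<close> this \<open>\<rho> > 0\<close>, of n]
      show ?case using \<open>\<rho> > 0\<close> V unfolding times_divide_eq_right
        by (intro divide_right_mono) simp_all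
    qed
  qed
qed

end
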